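(* For $n\geq 9$, $a_n(123;321) = 0$.
   Context: $\mathcal{S}_n$ is the set of permutations of $[n]=\{1,\dots,n\}$, written in one-line notation $\pi=\pi_1\pi_2\cdots\pi_n$ with $\pi_i=\pi(i)$. A permutation is cyclic if it consists of exactly one $n$-cycle. For a cyclic $\pi$, its standard cycle notation is $C(\pi)=(c_1,c_2,\dots,c_n)$ with $c_1=1$ and $c_i=\pi_{c_{i-1}}$ for $2\le i\le n$. A sequence of distinct integers $w_1\cdots w_m$ contains a pattern $\sigma\in\mathcal{S}_k$ if there are indices $i_1<\dots<i_k$ with $w_{i_1}\cdots w_{i_k}$ in the same relative order as $\sigma_1\cdots\sigma_k$; otherwise it avoids $\sigma$. For $\sigma,\tau\in\mathcal{S}_3$, $\mathcal{A}_n(\sigma;\tau)$ is the set of cyclic permutations $\pi\in\mathcal{S}_n$ whose one-line notation avoids $\sigma$ and whose cycle notation $C(\pi)$ (as the sequence $c_1c_2\cdots c_n$) avoids $\tau$; $a_n(\sigma;\tau)=|\mathcal{A}_n(\sigma;\tau)|$. *)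

theory Defs
  imports "HOL-Combinatorics.Combinatorics"
begin

text \<open>Sequences are lists of natural numbers. List positions start at 0, so the entry
  \<open>w\<^sub>i\<close> of a sequence is \<open>w ! (i - 1)\<close>; values keep their meaning in \<open>{1..n}\<close>.
  Patterns are given by their one-line notation, e.g. \<open>[3,2,1]\<close> for 321.\<close>

definition one_line :: "nat \<Rightarrow> (nat \<Rightarrow> nat) \<Rightarrow> nat list" where
  "one_line n \<pi> = map \<pi> [1..<Suc n]"

text \<open>The recursion \<open>c\<^sub>1 = 1\<close>, \<open>c\<^sub>i = \<pi> c\<^sub>i\<^sub>-\<^sub>1\<close> gives \<open>c\<^sub>i = \<pi>\<^sup>i\<^sup>-\<^sup>1 1\<close>.\<close>

definition cycle_notation :: "nat \<Rightarrow> (nat \<Rightarrow> nat) \<Rightarrow> nat list" where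
  "cycle_notation n \<pi> = map (\<lambda>i. (\<pi> ^^ i) 1) [0..<n]"

definition same_relative_order :: "nat list \<Rightarrow> nat list \<Rightarrow> bool" where
  "same_relative_order u v \<longleftrightarrow>
     length u = length v \<and>
     (\<forall>i < length u. \<forall>j < length u. u ! i < u ! j \<longleftrightarrow> v ! i < v ! j)"

definition contains_pattern :: "nat list \<Rightarrow> nat list \<Rightarrow> bool" where
  "contains_pattern w \<sigma> \<longleftrightarrow>
     (\<exists>is. sorted_wrt (<) is \<and> set is \<subseteq> {..<length w} \<and>
           same_relative_order (map (\<lambda>i. w ! i) is) \<sigma>)"

abbreviation avoids_pattern :: "nat list \<Rightarrow> nat list \<Rightarrow> bool" where
  "avoids_pattern w \<sigma> \<equiv> \<not> contains_pattern w \<sigma>"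

definition cyclic_avoiders :: "nat \<Rightarrow> nat list \<Rightarrow> nat list \<Rightarrow> (nat \<Rightarrow> nat) set" where
  "cyclic_avoiders n \<sigma> \<tau> =
     {\<pi>. \<pi> permutes {1..n} \<and> cyclic_on \<pi> {1..n} \<and>
         avoids_pattern (one_line n \<pi>) \<sigma> \<and> avoids_pattern (cycle_notation n \<pi>) \<tau>}"

definition num_cyclic_avoiders :: "nat \<Rightarrow> nat list \<Rightarrow> nat list \<Rightarrow> nat" where
  "num_cyclic_avoiders n \<sigma> \<tau> = card (cyclic_avoiders n \<sigma> \<tau>)"

text \<open>Hence a value 0 of the count really means that there are no such permutations.\<close>

lemma finite_cyclic_avoiders: "finite (cyclic_avoiders n \<sigma> \<tau>)"
  by (rule finite_subset[OF _ finite_permutations[of "{1..n}"]])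
     (auto simp: cyclic_avoiders_def)

end

theory Submission
  imports Defs
begin

text \<open>Let \<open>q\<close> be the position with \<open>\<pi> q = n\<close>. By 321-avoidance the entries of \<open>C(\<pi>)\<close> after
  \<open>n\<close> increase, as do those before 2. A consecutive increasing run of four entries of
  \<open>C(\<pi>)\<close> is an increasing run of three values of \<open>\<pi>\<close> at increasing positions, so 2 is among the
  first four entries and \<open>n\<close> among the last four. If \<open>\<pi> 2 > 3\<close>, then either
  \<open>\<pi> 1 < \<pi> 2 < \<pi> q\<close> is a 123, or \<open>\<pi> 1\<close>, \<open>\<pi> 2\<close>, 3 is a 321 in \<open>C(\<pi>)\<close>; so \<open>\<pi> 2 = 3\<close>, and
  avoiding \<open>\<pi> 2 < \<pi> 3 < \<pi> q\<close> forces \<open>\<pi> 3 = n\<close>. Hence \<open>n\<close> is among the first six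
  entries, which leaves three increasing entries \<open>x < y < z\<close> right after it, and
  \<open>\<pi> 2 < \<pi> x < \<pi> y\<close> is a 123.\<close>

lemma contains_patternI3:
  assumes "i < j" "j < k" "k < length w" "same_relative_order [w ! i, w ! j, w ! k] \<sigma>"
  shows "contains_pattern w \<sigma>"
  unfolding contains_pattern_def
  by (rule exI[of _ "[i, j, k]"]) (use assms in auto)

lemma same_relative_order_123: "a < b \<Longrightarrow> b < c \<Longrightarrow> same_relative_order [a, b, c] [1, 2, 3]"
  by (auto simp: same_relative_order_def less_Suc_eq numeral_eq_Suc)

lemma same_relative_order_321: "a > b \<Longrightarrow> b > c \<Longrightarrow> same_relative_order [a, b, c] [3, 2, 1]"
  by (auto simp: same_relative_order_def less_Suc_eq numeral_eq_Suc)

lemma one_line_avoids_123D: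
  assumes "avoids_pattern (one_line n \<pi>) [1, 2, 3]" "1 \<le> x" "x < y" "y < z" "z \<le> n"
  shows "\<not> (\<pi> x < \<pi> y \<and> \<pi> y < \<pi> z)"
proof
  assume *: "\<pi> x < \<pi> y \<and> \<pi> y < \<pi> z"
  have "one_line n \<pi> ! (u - 1) = \<pi> u" if "1 \<le> u" "u \<le> n" for u
    using that by (simp add: one_line_def del: upt_Suc)
  with * assms have "contains_pattern (one_line n \<pi>) [1, 2, 3]"
    using same_relative_order_123[of "\<pi> x" "\<pi> y" "\<pi> z"]
    by (intro contains_patternI3[of "x - 1" "y - 1" "z - 1"])
       (auto simp: one_line_def simp del: upt_Suc)
  with assms(1) show False by blast
qed

lemma cycle_notation_avoids_321D:
  assumes "avoids_pattern (cycle_notation n \<pi>) [3, 2, 1]" "i < j" "j < k" "k < n"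
  shows "\<not> ((\<pi> ^^ i) 1 > (\<pi> ^^ j) 1 \<and> (\<pi> ^^ j) 1 > (\<pi> ^^ k) 1)"
  using assms contains_patternI3[of i j k "cycle_notation n \<pi>" "[3, 2, 1]"]
    same_relative_order_321[of "(\<pi> ^^ j) 1" "(\<pi> ^^ i) 1" "(\<pi> ^^ k) 1"]
  by (auto simp: cycle_notation_def)

text \<open>\<open>S\<close> is the orbit of \<open>s\<close>, and the iterates of \<open>s\<close>
  are distinct until the first return to \<open>s\<close>; the return time
  \<open>funpow_dist1 f s s\<close> is therefore the cardinality of \<open>S\<close>.\<close>

lemma cyclic_on_bij_betw_funpow:
  assumes "cyclic_on f S" "s \<in> S"
  shows "bij_betw (\<lambda>i. (f ^^ i) s) {0..<card S} S"
proof -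
  have S: "S = orbit f s" using assms by (metis cyclic_on_alldef)
  let ?d = "funpow_dist1 f s s"
  have s: "s \<in> orbit f s" using assms S by blast
  have "bij_betw (\<lambda>i. (f ^^ i) s) {0..<?d} S"
    unfolding bij_betw_def using s S orbit_conv_funpow_dist1[OF s] inj_on_funpow_dist1[OF s] by auto
  moreover from this have "card S = ?d" by (metis bij_betw_same_card card_atLeastLessThan diff_zero)
  ultimately show ?thesis by simp
qed

lemma cyclic_avoiders_123_321_empty:
  assumes n: "n \<ge> 9"
  shows "cyclic_avoiders n [1, 2, 3] [3, 2, 1] = {}"
proof (rule equals0I)
  fix \<pi> assume "\<pi> \<in> cyclic_avoiders n [1, 2, 3] [3, 2, 1]"
  then have cyc: "cyclic_on \<pi> {1..n}"
    and av: "avoids_pattern (one_line n \<pi>) [1, 2, 3]"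
      "avoids_pattern (cycle_notation n \<pi>) [3, 2, 1]"
    by (auto simp: cyclic_avoiders_def)
  define c where "c i = (\<pi> ^^ i) 1" for i
  have bij: "bij_betw c {0..<n} {1..n}"
    using cyclic_on_bij_betw_funpow[OF cyc, of 1] n by (simp add: c_def[abs_def])
  have no123: "\<not> (\<pi> x < \<pi> y \<and> \<pi> y < \<pi> z)" if "1 \<le> x" "x < y" "y < z" "z \<le> n" for x y z
    using one_line_avoids_123D[OF av(1)] that by blast
  have no321: "\<not> (c i > c j \<and> c j > c k)" if "i < j" "j < k" "k < n" for i j k
    using cycle_notation_avoids_321D[OF av(2)] that by (simp add: c_def)
  have c0: "c 0 = 1" by (simp add: c_def)
  have step: "\<pi> (c i) = c (Suc i)" for i by (simp add: c_def)
  have inj: "c i = c j \<longleftrightarrow> i = j" if "i < n" "j < n" for i j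
    using bij that by (auto simp: bij_betw_def inj_on_eq_iff)
  have rng: "1 \<le> c i \<and> c i \<le> n" if "i < n" for i
    using bij_betwE[OF bij] that by auto
  have ex: "\<exists>i<n. c i = x" if "1 \<le> x" "x \<le> n" for x
  proof -
    have "x \<in> c ` {0..<n}" using bij_betw_imp_surj_on[OF bij] that by auto
    then show ?thesis by auto
  qed
  have no_run: "\<not> (c i < c (i+1) \<and> c (i+1) < c (i+2) \<and> c (i+2) < c (i+3))" if "i + 3 < n" for i
    using no123[of "c i" "c (i+1)" "c (i+2)"] rng[of i] rng[of "i+2"] that
    by (auto simp: step numeral_eq_Suc)

  obtain k where k: "k < n" "c k = n" using ex[of n] n by auto
  have after_n: "c i < c j" if "k < i" "i < j" "j < n" for i j
    using no321[of k i j] rng[of i] inj[of i k] inj[of i j] k that by fastforce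
  have "n \<le> k + 4"
  proof (rule ccontr)
    assume "\<not> n \<le> k + 4"
    then show False using no_run[of "k+1"] after_n[of "k+1" "k+2"] after_n[of "k+2" "k+3"]
        after_n[of "k+3" "k+4"] by (simp add: numeral_eq_Suc)
  qed
  \<comment> \<open>So \<open>q\<close>, at index \<open>k - 1 >= 4\<close>, comes strictly after 2,
    whose index will turn out to be at most 3.\<close>
  then have k5: "k \<ge> 5" using n by simp
  define q where "q = c (k - 1)"
  have q: "q \<le> n" "\<pi> q = n"
    using rng[of "k - 1"] k k5 step[of "k - 1"] by (auto simp: q_def)

  obtain m where m: "m < n" "c m = 2" using ex[of 2] n by auto
  have m0: "m \<noteq> 0" using m c0 by (metis one_eq_numeral_iff semiring_norm(85))
  have before_2: "c i < c j" if "i < j" "j < m" for i j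
  \<comment> \<open>The entry 1 at index 0 is least; a later descent before index \<open>m\<close>
    would form a 321 with \<open>c m = 2\<close>.\<close>
  proof (cases "i = 0")
    case True
    then show ?thesis using c0 rng[of j] inj[of j 0] that m by fastforce
  next
    case False
    then have "c j \<noteq> 2" "c j \<noteq> c 0" "c i \<noteq> c j" "c j \<ge> 1"
      using inj[of j m] inj[of j 0] inj[of i j] rng[of j] that m by auto
    then show ?thesis using no321[of i j m] that m c0 by fastforce
  qed
  have m3: "m \<le> 3"
  proof (rule ccontr)
    assume "\<not> m \<le> 3"
    then show False using no_run[of 0] before_2[of 0 1] before_2[of 1 2] before_2[of 2 3] m
      by (simp add: numeral_eq_Suc)
  qed
  have pi1: "\<pi> 1 = c 1" and pi2: "\<pi> 2 = c (m+1)" using step[of 0] step[of m] c0 m by auto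
  have q_ne: "q \<noteq> c i" if "i < k - 1" for i
    using inj[of "k-1" i] that k by (auto simp: q_def)
  have q2: "q > 2"
  proof -
    have "q \<noteq> 2" if "m \<noteq> k - 1" using q_ne[of m] m that k5 m3 by auto
    moreover have "q \<noteq> 1" using q_ne[of 0] c0 k5 by auto
    moreover have "q \<ge> 1" using rng[of "k-1"] k by (auto simp: q_def)
    ultimately show ?thesis using m3 k5 by fastforce
  qed
  have pi2_less: "\<pi> 2 < n"
    using rng[of "m+1"] inj[of "m+1" k] k k5 m3 n pi2 by fastforce
  have pi2_gt: "\<pi> 2 > 2"
  proof -
    have "c (m+1) \<noteq> c 0" "c (m+1) \<noteq> c m" "c (m+1) \<ge> 1"
      using inj[of "m+1" 0] inj[of "m+1" m] rng[of "m+1"] m3 n by auto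
    then show ?thesis using c0 m pi2 by auto
  qed
  have desc: "\<not> \<pi> 1 < \<pi> 2"
    using no123[of 1 2 q] q q2 pi2_less by auto
  have pi2_3: "\<pi> 2 = 3"
  proof (rule ccontr)
    assume "\<pi> 2 \<noteq> 3"
    then have v: "c (m+1) > 3" using pi2_gt pi2 by auto
    \<comment> \<open>Strict because \<open>m > 0\<close> makes the indices 1 and \<open>m+1\<close>
      distinct.\<close>
    have u: "c 1 > c (m+1)" using desc pi1 pi2 inj[of 1 "m+1"] m0 m3 n by fastforce
    obtain l where l: "l < n" "c l = 3" using ex[of 3] n by auto
    \<comment> \<open>Otherwise 3 would lie strictly between indices 1 and \<open>m\<close>, and
      \<open>before_2\<close> would give \<open>c 1 < 3\<close>.\<close>
    have "l > m + 1"
    proof (rule ccontr)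
      assume "\<not> l > m + 1"
      moreover have "c l \<noteq> c (m+1)" "c l \<noteq> c m" "c l \<noteq> c 0" "c l \<noteq> c 1"
        using l v u m c0 by auto
      then have "l \<noteq> m + 1" "l \<noteq> m" "l \<noteq> 0" "l \<noteq> 1" by metis+
      ultimately show False using before_2[of 1 l] l u v by auto
    qed
    then show False using no321[of 1 "m+1" l] l u v m0 by auto
  qed
  have pi3: "\<pi> 3 = c (m+2)" using step[of "m+1"] pi2 pi2_3 by simp
  have "k = m + 2"
  proof (rule ccontr)
    assume nk: "k \<noteq> m + 2"
    have "c (m+2) \<noteq> c 0" "c (m+2) \<noteq> c m" "c (m+2) \<noteq> c (m+1)" "c (m+2) \<ge> 1"
      using inj[of "m+2" 0] inj[of "m+2" m] inj[of "m+2" "m+1"] rng[of "m+2"] m3 n by auto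
    then have "\<pi> 3 > 3" using pi2 pi2_3 pi3 c0 m by auto
    moreover have "\<pi> 3 < n"
      using pi3 rng[of "m+2"] inj[of "m+2" k] nk k m3 n by fastforce
    \<comment> \<open>\<open>q = 3\<close> would mean \<open>\<pi> 3 = n\<close>.\<close>
    moreover have "q > 3"
      using q2 q_ne[of "m+1"] pi2 pi2_3 nk k5 m3 q \<open>\<pi> 3 < n\<close> by (cases "q = 3") auto
    ultimately show False using no123[of 2 3 q] q pi2_3 by auto
  qed
  \<comment> \<open>Now \<open>k <= 5\<close>, so \<open>n >= 9\<close> makes \<open>k+1\<close>,
    \<open>k+2\<close> and \<open>k+3\<close> valid indices.\<close>
  then have kn: "k + 3 < n" using m3 n by simp
  have ge: "c i > 3" if "k < i" "i < n" for i
  proof -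
    \<comment> \<open>The values 1, 2, 3 sit at indices 0, \<open>m\<close>, \<open>m+1\<close>, all
      below \<open>k\<close>.\<close>
    have "c i \<noteq> c 0" "c i \<noteq> c m" "c i \<noteq> c (m+1)" "c i \<ge> 1"
      using inj[of i 0] inj[of i m] inj[of i "m+1"] rng[of i] that \<open>k = m + 2\<close> by auto
    then show ?thesis using pi2 pi2_3 c0 m by auto
  qed
  show False
    \<comment> \<open>Positions \<open>2 < c (k+1) < c (k+2)\<close> carry the values
      \<open>3 < c (k+2) < c (k+3)\<close>.\<close>
    using no123[of 2 "c (k+1)" "c (k+2)"] ge[of "k+1"] ge[of "k+2"] after_n[of "k+1" "k+2"]
      after_n[of "k+2" "k+3"] rng[of "k+2"] step[of "k+1"] step[of "k+2"] kn pi2_3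
    by (auto simp: numeral_eq_Suc)
qed

theorem theorem6p2:
  fixes n :: nat
  assumes "n \<ge> 9"
  shows "num_cyclic_avoiders n [1, 2, 3] [3, 2, 1] = 0"
  using cyclic_avoiders_123_321_empty[OF assms] by (simp add: num_cyclic_avoiders_def)

end
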